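(* The composite $\mathcal{B}\circ\mathcal{M}\colon\mathbb{R}_{>0}\to\mathbb{R}_{>0}$, $x\mapsto\mathcal{B}(\mathcal{M}(x))$, takes the value $$V(x)=\frac{\pi^{x/2}}{\Gamma(x/2+1)},\qquad x>0.$$ At integer $x=n\in\mathbb{Z}_{\ge 1}$, $V(n)$ equals the classical Lebesgue volume of the unit ball in $\mathbb{R}^n$.
   Context: For real $x>0$, $\mathcal{M}(x)$ is the positive Radon measure on $(0,\infty)$ given by $$d\mathcal{M}(x)(u)=\frac{\pi^{x/2}}{\Gamma(x/2)}\,u^{x/2-1}\,du$$ (this is the object part of the Mellin--Gamma functor $\mathcal{M}$, whose set of source objects is $\mathbb{R}_{>0}$). The unit-interval observable $\mathcal{B}$ assigns to a positive Radon measure $\mu$ on $(0,\infty)$ the number $\mathcal{B}(\mu):=\mu\bigl((0,1)\bigr)$. Write $V(x):=\mathcal{B}(\mathcal{M}(x))=\mathcal{M}(x)\bigl((0,1)\bigr)$. *)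

theory Defs
  imports "HOL-Analysis.Analysis"
begin

(* A measure on (0,\<infinity>) is a real measure whose space is {0<..}, with the trace of the
   Borel sigma-algebra. *)
definition mellin_gamma :: "real \<Rightarrow> real measure" where
  "mellin_gamma x = density (restrict_space lborel {0<..})
     (\<lambda>u. ennreal (pi powr (x / 2) / Gamma (x / 2) * u powr (x / 2 - 1)))"

(* Valued in ennreal because a Radon measure on (0,\<infinity>) may give (0,1) infinite mass;
   the real-valued "measure" would silently return 0 there. *)
definition unit_interval_observable :: "real measure \<Rightarrow> ennreal" where
  "unit_interval_observable \<mu> = emeasure \<mu> {0<..<1}"

definition V :: "real \<Rightarrow> ennreal" where
  "V x = unit_interval_observable (mellin_gamma x)"

end

theory Submission
  imports Defs
begin

text \<open>The mass of \<open>(0,1)\<close> is a constant times the integral of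
  \<open>u powr (x/2 - 1)\<close>, which is \<open>1 / (x/2)\<close> since \<open>x/2 > 0\<close>
  (\<open>nn_integral_powr_unit_interval\<close>). The functional equation
  \<open>Gamma (x/2 + 1) = x/2 * Gamma (x/2)\<close> absorbs that factor, leaving
  \<open>unit_ball_vol x\<close>, which the library defines for real \<open>x\<close>
  (\<open>V_eq_unit_ball_vol\<close>). Positivity, finiteness and the ball volumes follow from known
  facts about \<open>unit_ball_vol\<close>.\<close>

lemma nn_integral_powr_unit_interval:
  fixes a :: real
  assumes "a > 0"
  shows "(\<integral>\<^sup>+u\<in>{0<..<1}. ennreal (u powr (a - 1)) \<partial>lborel) = ennreal (1 / a)"
proof -
  have "((\<lambda>u. u powr (a - 1)) has_integral 1 / a) {0..1}"
    using has_integral_powr_from_0[of "a - 1" 1] assms by simp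
  \<comment> \<open>The endpoints are negligible, so the closed interval may be opened. For
    \<open>a < 1\<close> the integrand is unbounded near 0, but nonnegativity lets the gauge
    integral pass to the Lebesgue one.\<close>
  hence "((\<lambda>u. u powr (a - 1)) has_integral 1 / a) {0<..<1}"
    by (simp only: has_integral_Icc_iff_Ioo)
  thus ?thesis
    by (intro nn_integral_has_integral_lebesgue') auto
qed

lemma V_eq_unit_ball_vol:
  assumes "x > 0"
  shows "V x = ennreal (unit_ball_vol x)"
proof -
  define c where "c = pi powr (x / 2) / Gamma (x / 2)"
  have Gamma_pos: "Gamma (x / 2) > 0"
    using assms by (intro Gamma_real_pos) auto
  hence c: "c \<ge> 0"
    by (simp add: c_def)
  have Gamma_step: "Gamma (x / 2 + 1) = x / 2 * Gamma (x / 2)"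
    using assms by (intro Gamma_plus1) (auto elim!: nonpos_Ints_cases)
  have "V x = (\<integral>\<^sup>+u\<in>{0<..<1}. ennreal (c * u powr (x / 2 - 1)) \<partial>restrict_space lborel {0<..})"
    unfolding V_def unit_interval_observable_def mellin_gamma_def c_def
  proof (rule emeasure_density)
    show "(\<lambda>u. ennreal (pi powr (x / 2) / Gamma (x / 2) * u powr (x / 2 - 1)))
            \<in> borel_measurable (restrict_space lborel {0<..})"
      by (rule measurable_restrict_space1) measurable
    show "{0<..<1} \<in> sets (restrict_space lborel {0::real<..})"
      by (subst sets_restrict_space_iff) auto
  qed
  \<comment> \<open>The indicator of \<open>{0<..}\<close> coming from the restriction is absorbed
    by that of \<open>{0<..<1}\<close>; \<open>c \<ge> 0\<close> allows \<open>ennreal\<close> to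
    split over the product.\<close>
  also have "\<dots> = (\<integral>\<^sup>+u. ennreal c * (ennreal (u powr (x / 2 - 1)) * indicator {0<..<1} u) \<partial>lborel)"
    by (subst nn_integral_restrict_space, simp, rule nn_integral_cong)
       (simp add: indicator_def ennreal_mult' c)
  also have "\<dots> = ennreal c * (\<integral>\<^sup>+u\<in>{0<..<1}. ennreal (u powr (x / 2 - 1)) \<partial>lborel)"
    by (rule nn_integral_cmult) measurable
  also have "\<dots> = ennreal (c * (1 / (x / 2)))"
    using nn_integral_powr_unit_interval[of "x / 2"] assms c by (simp flip: ennreal_mult)
  also have "c * (1 / (x / 2)) = unit_ball_vol x"
    by (simp add: c_def unit_ball_vol_def Gamma_step)
  finally show ?thesis .
qed

theorem corollary8p1:
  shows "unit_interval_observable \<circ> mellin_gamma \<in> {0<..} \<rightarrow> {0<..<\<infinity>} \<and>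
    (\<forall>x::real. x > 0 \<longrightarrow> V x = ennreal (pi powr (x / 2) / Gamma (x / 2 + 1))) \<and>
    V (real CARD('n::finite)) = emeasure lebesgue (ball (0 :: real ^ 'n) 1) \<and>
    V (real CARD('n)) = emeasure lebesgue (cball (0 :: real ^ 'n) 1)"
proof (intro conjI allI impI)
  show "unit_interval_observable \<circ> mellin_gamma \<in> {0<..} \<rightarrow> {0<..<\<infinity>}"
    using V_eq_unit_ball_vol by (auto simp: V_def)
next
  fix x :: real
  assume "x > 0"
  thus "V x = ennreal (pi powr (x / 2) / Gamma (x / 2 + 1))"
    by (simp add: V_eq_unit_ball_vol unit_ball_vol_def)
next
  \<comment> \<open>\<open>CARD('n)\<close> is the dimension of \<open>real ^ 'n\<close>, so the
    library volume of a ball of radius 1 is \<open>unit_ball_vol\<close> at this argument.\<close>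
  show "V (real CARD('n)) = emeasure lebesgue (ball (0 :: real ^ 'n) 1)"
    by (simp add: V_eq_unit_ball_vol emeasure_ball)
  show "V (real CARD('n)) = emeasure lebesgue (cball (0 :: real ^ 'n) 1)"
    by (simp add: V_eq_unit_ball_vol emeasure_cball)
qed

end
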